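(* Let $s, n$ be integers with $s \geq 1$ and $n \geq 1$. Then there exist at most finitely many isomorphism classes of finite groups $G$ which contain a normal subgroup $N$ such that $|G:N|=n$ and $N$ contains exactly $s$ non-central $G$-classes. Moreover, for every such $G$ and $N$, $$|G| < n^{2^s+1}(s+1)\prod_{i=0}^{s-1}(s+1-i)^{2^{s-1-i}}$$ and $$|N| < n^{2^s}(s+1)\prod_{i=0}^{s-1}(s+1-i)^{2^{s-1-i}}.$$
   Context: For a finite group $G$, a normal subgroup $N$ of $G$ and $x \in N$, the $G$-class (or $G$-conjugacy class) of $x$ is $x^G=\{x^g \mid g\in G\}$, which is contained in $N$; thus $N$ is a disjoint union of $G$-classes. A $G$-class $x^G$ is non-central if $x\notin \mathbf{Z}(G)$, where $\mathbf{Z}(G)$ is the center of $G$ (equivalently, $|x^G|>1$). *)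

theory Defs
  imports "HOL-Algebra.Algebra"
begin

definition center :: "('a, 'b) monoid_scheme \<Rightarrow> 'a set" where
  "center G = {z \<in> carrier G. \<forall>g\<in>carrier G. z \<otimes>\<^bsub>G\<^esub> g = g \<otimes>\<^bsub>G\<^esub> z}"

definition conj_class :: "('a, 'b) monoid_scheme \<Rightarrow> 'a \<Rightarrow> 'a set" where
  "conj_class G x = {inv\<^bsub>G\<^esub> g \<otimes>\<^bsub>G\<^esub> x \<otimes>\<^bsub>G\<^esub> g | g. g \<in> carrier G}"

(* Conjugation is by elements of G, not just of N, and centrality refers to
   the center of G. *)
definition noncentral_classes :: "('a, 'b) monoid_scheme \<Rightarrow> 'a set \<Rightarrow> 'a set set" where
  "noncentral_classes G N = {conj_class G x | x. x \<in> N \<and> x \<notin> center G}"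

definition class_pair ::
    "nat \<Rightarrow> nat \<Rightarrow> ('a, 'b) monoid_scheme \<Rightarrow> 'a set \<Rightarrow> bool" where
  "class_pair s n G N \<longleftrightarrow>
     group G \<and> finite (carrier G) \<and> N \<lhd> G \<and>
     card (rcosets\<^bsub>G\<^esub> N) = n \<and> card (noncentral_classes G N) = s"

definition group_iso_rel :: "('a, 'b) monoid_scheme rel" where
  "group_iso_rel = {(G, H). group G \<and> group H \<and> G \<cong> H}"

lemma equiv_group_iso_rel: "equiv {G. group G} group_iso_rel"
  by (rule equivI)
    (auto simp: group_iso_rel_def refl_on_def sym_def trans_def
      intro: iso_refl group.iso_sym iso_trans)

(* There is no type of all groups. Every finite group is isomorphic to one whose
   carrier is a set of natural numbers, so the isomorphism classes of finite
   groups are taken among the groups on nat. *)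
definition class_pair_iso_classes :: "nat \<Rightarrow> nat \<Rightarrow> nat monoid set set" where
  "class_pair_iso_classes s n = {G. \<exists>N. class_pair s n G N} // group_iso_rel"

end

(* Write N as the disjoint union of Z = N \<inter> Z(G) and the s non-central classes, and divide
   the sizes by |G|: this expresses 1/n as a sum of s + 1 unit fractions, whose denominators are
   |G : Z| and the orders of the centralizers of representatives x of the classes. Landau's
   argument (the smallest denominator is at most (s + 1) n; subtract it and repeat) bounds the
   denominators. As Z lies properly in each centralizer C(x), |Z| < |C(x)|, and one of the two
   factors of |G| = |G : Z| |Z| is at most the smallest denominator, the other is
   at most the largest one. *)
theory Submission
  imports Defs
begin

section \<open>Landau's bound for sums of unit fractions\<close>

text \<open>Closed form of the recursion B(q, 0) = q, B(q, s + 1) = B((s + 2) q^2, s), which follows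
  the denominator of the remaining sum while terms are removed one at a time.\<close>

definition landau_bound :: "nat \<Rightarrow> nat \<Rightarrow> nat" where
  "landau_bound q s = q ^ (2 ^ s) * (\<Prod>i<s. (s + 1 - i) ^ (2 ^ (s - 1 - i)))"

lemma landau_bound_Suc: "landau_bound q (Suc s) = landau_bound ((s + 2) * q ^ 2) s"
proof -
  have "(\<Prod>i<Suc s. (Suc s + 1 - i) ^ (2 ^ (Suc s - 1 - i))) =
        (s + 2) ^ 2 ^ s * (\<Prod>i<s. (s + 1 - i) ^ (2 ^ (s - 1 - i)))"
    by (subst prod.lessThan_Suc_shift) simp
  then show ?thesis
    unfolding landau_bound_def by (simp only:) (simp only: power_mult_distrib power_Suc flip: power_mult, simp)
qed

lemma landau_bound_mono: "q \<le> r \<Longrightarrow> landau_bound q s \<le> landau_bound r s"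
  unfolding landau_bound_def by (intro mult_right_mono power_mono) auto

text \<open>No term exceeds \<open>1 / x m\<close>, while the sum is at least \<open>1 / q\<close>
  because \<open>p\<close> is at least 1.\<close>

lemma minimal_denominator_le:
  fixes x :: "'i \<Rightarrow> nat" and p q :: nat
  assumes "finite I" and m: "m \<in> I" "\<And>i. i \<in> I \<Longrightarrow> x m \<le> x i"
    and pos: "0 < x m" "1 \<le> p" "1 \<le> q"
    and sum: "(\<Sum>i\<in>I. 1 / real (x i)) = real p / real q"
  shows "x m \<le> card I * q"
proof -
  have "1 / real q \<le> real p / real q"
    using pos by (intro divide_right_mono) auto
  also have "\<dots> = (\<Sum>i\<in>I. 1 / real (x i))"
    using sum by simp
  also have "\<dots> \<le> (\<Sum>i\<in>I. 1 / real (x m))"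
    using m(2) pos by (intro sum_mono frac_le) auto
  also have "\<dots> = real (card I) / real (x m)"
    by simp
  finally have "real (x m) \<le> real (card I) * real q"
    using pos by (simp add: field_simps)
  then show ?thesis
    by (metis of_nat_le_iff of_nat_mult)
qed

text \<open>Induction on the number of terms, removing a largest fraction \<open>1 / x m\<close>.
  The rest sums to \<open>(p * x m - q) / (q * x m)\<close>, where
  \<open>x m \<le> (s + 2) * q\<close>. The numerator changes from round to round, hence a general
  \<open>p\<close>; the bound depends on the denominator alone.\<close>

lemma denominator_le_landau_bound:
  fixes x :: "'i \<Rightarrow> nat" and p q :: nat
  assumes "finite I" "card I = s + 1" "\<And>i. i \<in> I \<Longrightarrow> 0 < x i" "1 \<le> p" "1 \<le> q"
    and "(\<Sum>i\<in>I. 1 / real (x i)) = real p / real q" and "j \<in> I"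
  shows "x j \<le> landau_bound q s"
  using assms
proof (induction s arbitrary: I p q j)
  case 0
  then have "I = {j}"
    by (metis One_nat_def add_0 card_1_singletonE singletonD)
  then show ?case
    using minimal_denominator_le[of I j x p q] 0 by (simp add: landau_bound_def)
next
  case (Suc s)
  obtain m where m: "m \<in> I" "\<And>i. i \<in> I \<Longrightarrow> x m \<le> x i"
    using ex_has_least_nat[of "\<lambda>i. i \<in> I" j x] Suc.prems(7) by blast
  have xm: "x m \<le> (s + 2) * q" "0 < x m"
    using minimal_denominator_le[of I m x p q] Suc.prems m by auto
  let ?J = "I - {m}"
  have J: "finite ?J" "card ?J = s + 1"
    using Suc.prems m by auto
  then have "?J \<noteq> {}"
    by force
  \<comment> \<open>Positivity of the remaining sum makes \<open>p * x m - q\<close> a positive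
    natural number, so that truncated subtraction is exact and the induction hypothesis
    applies.\<close>
  then have "0 < (\<Sum>i\<in>?J. 1 / real (x i))"
    using Suc.prems J by (intro sum_pos) auto
  moreover have rest: "(\<Sum>i\<in>?J. 1 / real (x i)) = real p / real q - 1 / real (x m)"
    using Suc.prems(1,6) m by (simp add: sum_diff1)
  moreover have frac: "real p / real q - 1 / real (x m) =
      (real p * real (x m) - real q) / (real q * real (x m))"
    using xm Suc.prems by (simp add: field_simps)
  ultimately have "0 < real p * real (x m) - real q"
    using xm(2) Suc.prems(5) by (metis mult_pos_pos of_nat_0_less_iff zero_less_divide_iff
        less_le_trans zero_less_one not_less_iff_gr_or_eq)
  then have less: "q < p * x m"
    by (metis diff_gt_0_iff_gt of_nat_less_iff of_nat_mult)
  have "x i \<le> landau_bound q (Suc s)" if "i \<in> ?J" for i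
  proof -
    have "x i \<le> landau_bound (q * x m) s"
    proof (rule Suc.IH[OF J])
      show "(\<Sum>i\<in>?J. 1 / real (x i)) = real (p * x m - q) / real (q * x m)"
        using rest frac less by (simp add: of_nat_diff)
    qed (use Suc.prems xm less that in auto)
    also have "\<dots> \<le> landau_bound ((s + 2) * q ^ 2) s"
      using mult_le_mono2[OF xm(1), of q]
      by (intro landau_bound_mono) (simp only: power2_eq_square mult.left_commute)
    finally show ?thesis
      by (simp add: landau_bound_Suc)
  qed
  \<comment> \<open>The removed index \<open>m\<close> inherits the bound of any other index, as
    \<open>x m\<close> is minimal.\<close>
  moreover obtain i where "i \<in> ?J"
    using \<open>?J \<noteq> {}\<close> by blast
  ultimately show ?case
    using m(2)[of i] Suc.prems(7) by (metis Diff_iff empty_iff insert_iff order_trans)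
qed

lemma landau_product_bound:
  assumes "1 \<le> s"
  shows "n ^ (2 ^ s) * (s + 1) * (\<Prod>i = 0..s - 1. (s + 1 - i) ^ (2 ^ (s - 1 - i))) =
    (s + 1) * landau_bound n s"
proof -
  have "{0..s - 1} = {..<s}"
    using assms by auto
  then show ?thesis
    by (simp only: landau_bound_def mult.assoc mult.left_commute)
qed

section \<open>Conjugacy classes, center and centralizers\<close>

context group
begin

text \<open>Replacing \<open>g\<close> by its inverse turns one convention for conjugation into the
  other. This opens the way to disjointness of orbits and the orbit-stabilizer theorem.\<close>

lemma conj_class_eq_orbit:
  assumes "x \<in> carrier G"
  shows "conj_class G x = orbit G (\<lambda>g. \<lambda>h\<in>carrier G. g \<otimes> h \<otimes> inv g) x"
    (is "_ = ?O")
proof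
  show "conj_class G x \<subseteq> ?O"
    unfolding conj_class_def orbit_def using assms by clarsimp (metis inv_closed inv_inv)
  show "?O \<subseteq> conj_class G x"
    unfolding conj_class_def orbit_def using assms by clarsimp (metis inv_closed inv_inv)
qed

lemma self_in_conj_class: "x \<in> carrier G \<Longrightarrow> x \<in> conj_class G x"
  unfolding conj_class_def by (rule CollectI, rule exI[of _ \<one>]) auto

lemma conj_class_eq_or_disjoint:
  assumes "x \<in> carrier G" "y \<in> carrier G"
  shows "conj_class G x = conj_class G y \<or> conj_class G x \<inter> conj_class G y = {}"
proof -
  interpret group_action G "carrier G" "\<lambda>g. \<lambda>h\<in>carrier G. g \<otimes> h \<otimes> inv g"
    by (rule action_by_conjugation)
  show ?thesis
    using disjoint_union assms by (auto simp: conj_class_eq_orbit orbits_def)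
qed

lemma conj_class_central:
  assumes "z \<in> center G"
  shows "conj_class G z = {z}"
proof -
  have "inv g \<otimes> z \<otimes> g = z" if "g \<in> carrier G" for g
    using assms that by (simp add: center_def m_assoc inv_solve_left')
  then show ?thesis
    using self_in_conj_class[of z] assms unfolding conj_class_def by (auto simp: center_def)
qed

text \<open>A central element of the class would have a singleton class, equal to that of
  \<open>x\<close>, so it would be \<open>x\<close> itself.\<close>

lemma conj_class_noncentral_inter_center:
  assumes "x \<in> carrier G" "x \<notin> center G"
  shows "conj_class G x \<inter> center G = {}"
proof (rule ccontr)
  assume "conj_class G x \<inter> center G \<noteq> {}"
  then obtain z where z: "z \<in> conj_class G x" "z \<in> center G"
    by blast
  moreover have "z \<in> carrier G"
    using z by (simp add: center_def)
  ultimately have "conj_class G x = {z}"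
    using assms(1) conj_class_eq_or_disjoint[of x z] conj_class_central[of z] by auto
  then show False
    using self_in_conj_class[OF assms(1)] assms(2) z by simp
qed

lemma subgroup_center: "subgroup (center G) G"
proof (rule subgroupI)
  fix a assume "a \<in> center G"
  then show "inv a \<in> center G"
    by (auto simp: center_def) (metis inv_closed inv_inv inv_mult_group)
next
  fix a b assume "a \<in> center G" "b \<in> center G"
  then have a: "a \<in> carrier G" "\<And>g. g \<in> carrier G \<Longrightarrow> a \<otimes> g = g \<otimes> a"
    and b: "b \<in> carrier G" "\<And>g. g \<in> carrier G \<Longrightarrow> b \<otimes> g = g \<otimes> b"
    by (auto simp: center_def)
  have "a \<otimes> b \<otimes> g = g \<otimes> (a \<otimes> b)" if g: "g \<in> carrier G" for g
  proof -
    have "a \<otimes> b \<otimes> g = a \<otimes> (g \<otimes> b)"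
      using a(1) b g by (simp add: m_assoc)
    also have "\<dots> = a \<otimes> g \<otimes> b"
      using a(1) b(1) g by (simp add: m_assoc)
    also have "\<dots> = g \<otimes> (a \<otimes> b)"
      using a b(1) g by (simp add: m_assoc)
    finally show ?thesis .
  qed
  then show "a \<otimes> b \<in> center G"
    using a(1) b(1) by (simp add: center_def)
qed (auto simp: center_def)

text \<open>The number \<open>c\<close> is the order of the centralizer of \<open>x\<close>, the
  stabilizer of \<open>x\<close> under conjugation. It contains \<open>Z\<close> properly, since
  \<open>x\<close> commutes with itself but is not central.\<close>

lemma card_center_less_centralizer:
  assumes "finite (carrier G)" "Z \<subseteq> center G" "x \<in> carrier G" "x \<notin> center G"
  obtains c where "card (conj_class G x) * c = order G" "card Z < c"
proof -
  interpret group_action G "carrier G" "\<lambda>g. \<lambda>h\<in>carrier G. g \<otimes> h \<otimes> inv g"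
    by (rule action_by_conjugation)
  let ?C = "stabilizer G (\<lambda>g. \<lambda>h\<in>carrier G. g \<otimes> h \<otimes> inv g) x"
  have "finite ?C"
    using assms(1) stabilizer_subset by (rule finite_subset[rotated])
  moreover have "Z \<subset> ?C"
  proof -
    have "z \<otimes> x \<otimes> inv z = x" if "z \<in> Z" for z
      using that assms by (auto simp: center_def subset_iff m_assoc)
    then have "Z \<subseteq> ?C"
      using assms by (auto simp: stabilizer_def center_def)
    moreover have "x \<in> ?C"
      using assms by (auto simp: stabilizer_def m_assoc)
    ultimately show ?thesis
      using assms by auto
  qed
  ultimately have "card Z < card ?C"
    by (rule psubset_card_mono)
  then show ?thesis
    using that orbit_stabilizer_theorem[of x] assms by (simp add: conj_class_eq_orbit)
qed

end

section \<open>The class equation of a normal subgroup\<close>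

lemma (in normal) conj_class_subset: "x \<in> H \<Longrightarrow> conj_class G x \<subseteq> H"
  using inv_op_closed1 by (auto simp: conj_class_def)

text \<open>The central classes are merged into the single block \<open>H \<inter> center G\<close>.
  This block differs from every non-central class, so s such classes give exactly s + 1
  blocks.\<close>

lemma (in normal) card_eq_central_plus_noncentral:
  assumes "finite (carrier G)"
  shows "finite (noncentral_classes G H)" "H \<inter> center G \<notin> noncentral_classes G H"
    "(\<Sum>S \<in> insert (H \<inter> center G) (noncentral_classes G H). card S) = card H"
proof -
  let ?I = "insert (H \<inter> center G) (noncentral_classes G H)"
  have H: "x \<in> carrier G" if "x \<in> H" for x
    using that subset by auto
  have disj: "S \<inter> center G = {}" if "S \<in> noncentral_classes G H" for S
    using that conj_class_noncentral_inter_center[OF H] by (auto simp: noncentral_classes_def)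
  have un: "\<Union>?I = H"
  proof
    show "\<Union>?I \<subseteq> H"
      using conj_class_subset by (auto simp: noncentral_classes_def)
    show "H \<subseteq> \<Union>?I"
      using self_in_conj_class[OF H] by (auto simp: noncentral_classes_def)
  qed
  have fin: "finite H"
    using assms subset finite_subset by auto
  then show "finite (noncentral_classes G H)"
    using un by (metis finite_UnionD finite_insert)
  \<comment> \<open>The block contains the identity, while non-central classes miss the
    center.\<close>
  show "H \<inter> center G \<notin> noncentral_classes G H"
    using disj[of "H \<inter> center G"] subgroup.one_closed[OF subgroup_center]
      subgroup.one_closed[OF subgroup_axioms] by blast
  have "card (\<Union>?I) = (\<Sum>S \<in> ?I. card S)"
  proof (rule card_Union_disjoint)
    have "S \<inter> T = {}"
      if ST: "S \<in> noncentral_classes G H" "T \<in> noncentral_classes G H" "S \<noteq> T" for S T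
    proof -
      obtain x y where "x \<in> H" "y \<in> H" "S = conj_class G x" "T = conj_class G y"
        using ST by (auto simp: noncentral_classes_def)
      then show ?thesis
        using conj_class_eq_or_disjoint[OF H H] ST(3) by metis
    qed
    then show "pairwise disjnt ?I"
      using disj by (auto simp: pairwise_def disjnt_def)
    show "finite S" if "S \<in> ?I" for S
      using that un fin by (metis Sup_upper finite_subset)
  qed
  then show "(\<Sum>S \<in> ?I. card S) = card H"
    using un by simp
qed

section \<open>The bound on the group order\<close>

lemma class_pair_order: "class_pair s n G N \<Longrightarrow> order G = n * card N"
  using group.lagrange[of G N] normal_imp_subgroup[of N G] by (auto simp: class_pair_def)

lemma class_pair_order_less:
  assumes cp: "class_pair s n G N" and "1 \<le> s" "1 \<le> n"
  shows "order G < n * ((s + 1) * landau_bound n s)"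
proof -
  have fin: "finite (carrier G)" and sN: "card (noncentral_classes G N) = s"
    using cp by (auto simp: class_pair_def)
  interpret normal N G
    using cp by (simp add: class_pair_def)
  define Z where "Z = N \<inter> center G"
  define K where "K = noncentral_classes G N"
  \<comment> \<open>These are the denominators: the index of \<open>Z\<close> for the block
    \<open>Z\<close>, and the order of a centralizer for a non-central class. The division is exact
    by Lagrange and by the orbit-stabilizer theorem.\<close>
  define x where "x S = order G div card S" for S :: "'a set"
  have K: "finite K" "card K = s" "Z \<notin> K" "(\<Sum>S \<in> insert Z K. card S) = card N"
    using card_eq_central_plus_noncentral[OF fin] sN by (auto simp: K_def Z_def)
  have ord: "0 < order G"
    using fin order_gt_0_iff_finite by blast
  have Z: "card Z * x Z = order G"
  proof -
    have "subgroup Z G"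
      unfolding Z_def by (rule subgroups_Inter_pair[OF subgroup_axioms subgroup_center])
    then show ?thesis
      using lagrange unfolding x_def by (metis dvd_mult_div_cancel dvd_triv_right)
  qed
  have noncentral: "card S * x S = order G" "card Z < x S" if S: "S \<in> K" for S
  proof -
    obtain y where y: "y \<in> N" "y \<notin> center G" "S = conj_class G y"
      using S by (auto simp: K_def noncentral_classes_def)
    obtain c where c: "card S * c = order G" "card Z < c"
      using card_center_less_centralizer[OF fin, of Z y] y subset by (auto simp: Z_def)
    then have "x S = c"
      using ord unfolding x_def by (metis mult_is_0 nonzero_mult_div_cancel_left less_irrefl)
    then show "card S * x S = order G" "card Z < x S"
      using c by auto
  qed
  let ?I = "insert Z K"
  have x: "card S * x S = order G" if "S \<in> ?I" for S
    using that Z noncentral by auto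
  then have xpos: "0 < x S" if "S \<in> ?I" for S
    using ord that by (metis gr0I less_irrefl mult_0_right)
  have I: "finite ?I" "card ?I = s + 1"
    using K by auto
  \<comment> \<open>This is the class equation of \<open>N\<close> divided by
    \<open>order G = n * card N\<close>; Landau's bound then applies with p = 1 and q = n.\<close>
  have sum: "(\<Sum>S\<in>?I. 1 / real (x S)) = real 1 / real n"
  proof -
    have "1 / real (x S) = real (card S) / real (order G)" if "S \<in> ?I" for S
    proof -
      have "real (order G) = real (card S) * real (x S)"
        using x[OF that] by (metis of_nat_mult)
      moreover have "0 < card S"
        using x[OF that] ord by (metis gr0I less_irrefl mult_0)
      ultimately show ?thesis
        by simp
    qed
    then have "(\<Sum>S\<in>?I. 1 / real (x S)) = real (\<Sum>S\<in>?I. card S) / real (order G)"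
      by (simp only: sum_divide_distrib of_nat_sum cong: sum.cong)
    also have "\<dots> = 1 / real n"
      using K(4) class_pair_order[OF cp] ord by (simp del: sum.insert)
    finally show ?thesis
      by simp
  qed
  have le: "x S \<le> landau_bound n s" if "S \<in> ?I" for S
    using denominator_le_landau_bound[OF I xpos _ _ sum that] assms by simp
  obtain M where M: "M \<in> ?I" "\<And>S. S \<in> ?I \<Longrightarrow> x M \<le> x S"
    using ex_has_least_nat[of "\<lambda>S. S \<in> ?I" Z x] by blast
  have xM: "x M \<le> n * (s + 1)"
    using minimal_denominator_le[OF I(1) M xpos[OF M(1)] _ _ sum] assms I by (simp add: mult.commute)
  have "card Z * x Z < n * (s + 1) * landau_bound n s"
  proof (cases "M = Z")
    \<comment> \<open>Here the index of \<open>Z\<close> is the smallest denominator. As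
      \<open>s \<ge> 1\<close>, some non-central class exists, and its centralizer bounds
      \<open>card Z\<close> strictly.\<close>
    case True
    obtain S where S: "S \<in> K"
      using K assms by fastforce
    have "card Z < landau_bound n s"
      using noncentral(2)[OF S] le[of S] S by simp
    moreover have "x Z \<le> n * (s + 1)" "0 < x Z"
      using True xM xpos[of Z] by auto
    ultimately have "x Z * card Z < n * (s + 1) * landau_bound n s"
      by (intro mult_le_less_imp_less) auto
    then show ?thesis
      by (simp add: mult.commute)
  next
    \<comment> \<open>Here the smallest denominator is the order of a centralizer, which exceeds
      \<open>card Z\<close>; the index of \<open>Z\<close> is bounded by
      \<open>landau_bound n s\<close>.\<close>
    case False
    then have "card Z < n * (s + 1)"
      using noncentral(2)[of M] M(1) xM by simp
    then show ?thesis
      using le[of Z] xpos[of Z] by (intro mult_less_le_imp_less) auto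
  qed
  then show ?thesis
    by (simp only: Z mult.assoc)
qed

section \<open>Finite groups as multiplication tables on natural numbers\<close>

text \<open>A finite stock of candidates, not all of them groups. Operations are extensional:
  without a fixed value outside \<open>{..<m}\<close>, each table would arise from infinitely many
  records.\<close>

definition nat_multiplication_tables :: "nat \<Rightarrow> nat monoid set" where
  "nat_multiplication_tables m = {\<lparr>carrier = {..<m}, monoid.mult = f, one = e\<rparr> | f e.
     f \<in> {..<m} \<rightarrow>\<^sub>E ({..<m} \<rightarrow>\<^sub>E {..<m}) \<and> e \<in> {..<m}}"

lemma finite_nat_multiplication_tables: "finite (nat_multiplication_tables m)"
proof -
  have "nat_multiplication_tables m = (\<lambda>(f, e). \<lparr>carrier = {..<m}, monoid.mult = f, one = e\<rparr>) `
      (({..<m} \<rightarrow>\<^sub>E ({..<m} \<rightarrow>\<^sub>E {..<m})) \<times> {..<m})"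
    by (auto simp: nat_multiplication_tables_def)
  then show ?thesis
    by (simp add: finite_PiE)
qed

text \<open>Transport of structure along an enumeration \<open>h\<close> of the carrier, with the
  operation restricted to keep it extensional.\<close>

lemma (in group) iso_nat_multiplication_table:
  assumes "finite (carrier G)"
  obtains H where "H \<in> nat_multiplication_tables (order G)" "group H" "G \<cong> H"
proof -
  obtain h where h: "bij_betw h (carrier G) {..<order G}"
    using ex_bij_betw_finite_nat[OF assms] by (auto simp: order_def atLeast0LessThan)
  define k where "k = inv_into (carrier G) h"
  have k: "k i \<in> carrier G" if "i < order G" for i
    using that h bij_betw_inv_into[OF h] by (auto simp: k_def bij_betw_def)
  have kh: "k (h x) = x" "h x < order G" if "x \<in> carrier G" for x
    using that h by (auto simp: k_def bij_betw_def)
  define H where "H = \<lparr>carrier = {..<order G},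
    monoid.mult = (\<lambda>i\<in>{..<order G}. \<lambda>j\<in>{..<order G}. h (k i \<otimes> k j)), one = h \<one>\<rparr>"
  have "H \<in> nat_multiplication_tables (order G)"
    unfolding H_def nat_multiplication_tables_def using k kh by auto
  moreover have iso: "h \<in> iso G H"
    using h kh by (auto simp: iso_def hom_def H_def)
  \<comment> \<open>The image-group rule yields a group after the unit is replaced by
    \<open>h \<one>\<close>, which already is the unit of \<open>H\<close>.\<close>
  moreover have "group H"
    using iso_imp_img_group[OF iso] by (simp add: H_def)
  ultimately show ?thesis
    using that is_isoI by blast
qed

section \<open>Invariance under isomorphism\<close>

lemma iso_conj_class:
  assumes "h \<in> iso G H" "group G" "group H" "x \<in> carrier G"
  shows "conj_class H (h x) = h ` conj_class G x"
proof -
  interpret G: group G by fact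
  interpret H: group H by fact
  interpret group_hom G H h
    using assms by unfold_locales (auto simp: iso_def)
  have eq: "h (inv\<^bsub>G\<^esub> g \<otimes>\<^bsub>G\<^esub> x \<otimes>\<^bsub>G\<^esub> g) = inv\<^bsub>H\<^esub> (h g) \<otimes>\<^bsub>H\<^esub> h x \<otimes>\<^bsub>H\<^esub> h g"
    if "g \<in> carrier G" for g
    using that assms by simp
  have "carrier H = h ` carrier G"
    using assms by (auto simp: iso_def bij_betw_def)
  then have "conj_class H (h x) = (\<lambda>g. inv\<^bsub>H\<^esub> (h g) \<otimes>\<^bsub>H\<^esub> h x \<otimes>\<^bsub>H\<^esub> h g) ` carrier G"
    by (auto simp: conj_class_def)
  also have "\<dots> = (\<lambda>g. h (inv\<^bsub>G\<^esub> g \<otimes>\<^bsub>G\<^esub> x \<otimes>\<^bsub>G\<^esub> g)) ` carrier G"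
    using eq by (auto intro!: image_cong)
  also have "\<dots> = h ` conj_class G x"
    by (auto simp: conj_class_def)
  finally show ?thesis .
qed

text \<open>By surjectivity it suffices to test commutation with the elements \<open>h g\<close>; by
  injectivity these commute with \<open>h x\<close> exactly when \<open>g\<close> commutes with
  \<open>x\<close>.\<close>

lemma iso_center_iff:
  assumes "h \<in> iso G H" "group G" "x \<in> carrier G"
  shows "h x \<in> center H \<longleftrightarrow> x \<in> center G"
proof -
  interpret G: group G by fact
  have inj: "inj_on h (carrier G)" and H: "carrier H = h ` carrier G"
    using assms by (auto simp: iso_def bij_betw_def)
  have "h x \<otimes>\<^bsub>H\<^esub> h g = h g \<otimes>\<^bsub>H\<^esub> h x \<longleftrightarrow> x \<otimes>\<^bsub>G\<^esub> g = g \<otimes>\<^bsub>G\<^esub> x" if "g \<in> carrier G" for g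
    using that assms inj by (metis G.m_closed hom_mult inj_on_eq_iff iso_imp_homomorphism)
  then show ?thesis
    using assms by (auto simp: center_def H)
qed

lemma iso_noncentral_classes:
  assumes "h \<in> iso G H" "group G" "group H" "N \<subseteq> carrier G"
  shows "noncentral_classes H (h ` N) = (`) h ` noncentral_classes G N"
proof -
  have "noncentral_classes H (h ` N) = conj_class H ` h ` {x \<in> N. x \<notin> center G}"
    using assms iso_center_iff[OF assms(1,2)] by (fastforce simp: noncentral_classes_def)
  also have "\<dots> = (\<lambda>x. h ` conj_class G x) ` {x \<in> N. x \<notin> center G}"
    using assms iso_conj_class[OF assms(1-3)] by (auto simp: image_image intro!: image_cong)
  also have "\<dots> = (`) h ` noncentral_classes G N"
    by (auto simp: noncentral_classes_def)
  finally show ?thesis .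
qed

text \<open>Lets a group on an arbitrary type be replaced by its copy on the natural
  numbers.\<close>

lemma class_pair_iso:
  assumes cp: "class_pair s n G N" and h: "h \<in> iso G H" and "group H"
  shows "class_pair s n H (h ` N)"
proof -
  have G: "group G" "finite (carrier G)" "N \<lhd> G"
    using cp by (auto simp: class_pair_def)
  interpret N: normal N G by fact
  interpret H: group H by fact
  have inj: "inj_on h (carrier G)" and carr: "carrier H = h ` carrier G"
    using h by (auto simp: iso_def bij_betw_def)
  have nrm: "h ` N \<lhd> H"
    using iso_normal_subgroup[OF h G(1) \<open>group H\<close> G(3)] .
  have cardN: "card (h ` N) = card N"
    using inj N.subset card_image inj_on_subset by blast
  \<comment> \<open>The index is recovered from Lagrange in \<open>H\<close> by cancelling the
    positive number \<open>card N\<close>.\<close>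
  have "card (rcosets\<^bsub>H\<^esub> (h ` N)) * card N = order H"
    using H.lagrange[OF normal_imp_subgroup[OF nrm]] cardN by simp
  moreover have "order H = n * card N"
    using class_pair_order[OF cp] inj carr by (simp add: order_def card_image)
  moreover have "0 < card N"
    using N.subset G(2) subgroup.one_closed[OF N.subgroup_axioms]
    by (metis card_gt_0_iff empty_iff finite_subset)
  ultimately have "card (rcosets\<^bsub>H\<^esub> (h ` N)) = n"
    by simp
  moreover have "card (noncentral_classes H (h ` N)) = s"
  proof -
    \<comment> \<open>Since \<open>h\<close> is injective on the carrier, taking images is injective
      on subsets of the carrier, so distinct classes stay distinct.\<close>
    have "noncentral_classes G N \<subseteq> Pow (carrier G)"
      using N.subset N.conj_class_subset by (fastforce simp: noncentral_classes_def)
    then have "inj_on ((`) h) (noncentral_classes G N)"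
      using inj_on_image_Pow[OF inj] inj_on_subset by blast
    then show ?thesis
      using cp iso_noncentral_classes[OF h G(1) \<open>group H\<close> N.subset]
      by (simp add: card_image class_pair_def)
  qed
  ultimately show ?thesis
    using G nrm \<open>group H\<close> carr by (simp add: class_pair_def)
qed

section \<open>Finitely many isomorphism classes and the final bounds\<close>

text \<open>Every isomorphism class is the class of some multiplication table whose size is below
  the order bound, and there are finitely many such tables.\<close>

lemma finite_class_pair_iso_classes:
  assumes "1 \<le> s" "1 \<le> n"
  shows "finite (class_pair_iso_classes s n)"
proof (rule finite_subset)
  let ?T = "\<Union>m<n * ((s + 1) * landau_bound n s). nat_multiplication_tables m"
  show "finite ((\<lambda>H. group_iso_rel `` {H}) ` ?T)"
    using finite_nat_multiplication_tables by auto
  show "class_pair_iso_classes s n \<subseteq> (\<lambda>H. group_iso_rel `` {H}) ` ?T"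
  proof
    fix C assume "C \<in> class_pair_iso_classes s n"
    then obtain G N where cp: "class_pair s n G N" and C: "C = group_iso_rel `` {G}"
      by (auto simp: class_pair_iso_classes_def quotient_def)
    then have G: "group G" "finite (carrier G)"
      by (auto simp: class_pair_def)
    obtain H where H: "H \<in> nat_multiplication_tables (order G)" "group H" "G \<cong> H"
      using group.iso_nat_multiplication_table[OF G] .
    then have "C = group_iso_rel `` {H}"
      unfolding C using G by (intro equiv_class_eq[OF equiv_group_iso_rel]) (simp add: group_iso_rel_def)
    moreover have "H \<in> ?T"
      using H(1) class_pair_order_less[OF cp assms] by auto
    ultimately show "C \<in> (\<lambda>H. group_iso_rel `` {H}) ` ?T"
      by blast
  qed
qed

text \<open>Carries the finiteness statement over to groups on any type: each of them belongs to one
  of the classes counted on the natural numbers.\<close>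

lemma class_pair_ex_iso_class:
  assumes cp: "class_pair s n G N"
  shows "\<exists>K\<in>class_pair_iso_classes s n. \<forall>H\<in>K. G \<cong> H"
proof -
  have G: "group G" "finite (carrier G)"
    using cp by (auto simp: class_pair_def)
  obtain H :: "nat monoid" where H: "group H" "G \<cong> H"
    using group.iso_nat_multiplication_table[OF G] .
  then have "\<exists>M. class_pair s n H M"
    using class_pair_iso[OF cp] by (auto simp: is_iso_def)
  then have "group_iso_rel `` {H} \<in> class_pair_iso_classes s n"
    by (auto simp: class_pair_iso_classes_def intro: quotientI)
  moreover have "\<forall>L \<in> group_iso_rel `` {H}. G \<cong> L"
    using H by (auto simp: group_iso_rel_def intro: iso_trans)
  ultimately show ?thesis
    by blast
qed

theorem theoremA:
  fixes s n :: nat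
  assumes "s \<ge> 1" and "n \<ge> 1"
  shows "finite (class_pair_iso_classes s n) \<and>
    (\<forall>(G :: ('a, 'b) monoid_scheme) N. class_pair s n G N \<longrightarrow>
       (\<exists>K\<in>class_pair_iso_classes s n. \<forall>H\<in>K. G \<cong> H) \<and>
       order G < n ^ (2 ^ s + 1) * (s + 1) * (\<Prod>i = 0..s - 1. (s + 1 - i) ^ (2 ^ (s - 1 - i))) \<and>
       card N < n ^ (2 ^ s) * (s + 1) * (\<Prod>i = 0..s - 1. (s + 1 - i) ^ (2 ^ (s - 1 - i))))"
proof (intro conjI allI impI)
  show "finite (class_pair_iso_classes s n)"
    using assms by (rule finite_class_pair_iso_classes)
next
  fix G :: "('a, 'b) monoid_scheme" and N
  let ?P = "\<Prod>i = 0..s - 1. (s + 1 - i) ^ (2 ^ (s - 1 - i))"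
  assume cp: "class_pair s n G N"
  then show "\<exists>K\<in>class_pair_iso_classes s n. \<forall>H\<in>K. G \<cong> H"
    by (rule class_pair_ex_iso_class)
  \<comment> \<open>The factor \<open>n\<close> is kept in front: absorbed into the power it gives
    the first bound, cancelled against \<open>order G = n * card N\<close> the second.\<close>
  have less: "order G < n * (n ^ (2 ^ s) * (s + 1) * ?P)"
    unfolding landau_product_bound[OF assms(1)] using class_pair_order_less[OF cp assms] .
  then show "order G < n ^ (2 ^ s + 1) * (s + 1) * ?P"
    by (simp only: power_add power_one_right mult.assoc mult.left_commute)
  show "card N < n ^ (2 ^ s) * (s + 1) * ?P"
    using less by (simp only: class_pair_order[OF cp] mult_less_cancel1)
qed

end
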